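(* The number of degrees of freedom of a Euclidean framework is a projective invariant. Precisely: let $(\Gamma,p)$ be a framework in $\mathbb{E}^d$, and let $\Phi\colon\mathbb{RP}^d\to\mathbb{RP}^d$ be a projective transformation (where $\mathbb{RP}^d$ is the projective completion of $\mathbb{E}^d$) such that $\Phi(p_i)\in\mathbb{E}^d$ for all $i\in\Gamma_0$. Then $(\Gamma,p)$ and $(\Gamma,\Phi\circ p)$ have the same number of (kinematic, equivalently static) degrees of freedom: $$\dim V(\Gamma,p)/V_0(\Gamma,p)=\dim V(\Gamma,\Phi\circ p)/V_0(\Gamma,\Phi\circ p),$$ $$\dim F(\Gamma,p)/F_0(\Gamma,p)=\dim F(\Gamma,\Phi\circ p)/F_0(\Gamma,\Phi\circ p).$$ In particular, $(\Gamma,p)$ is infinitesimally rigid if and only if $(\Gamma,\Phi\circ p)$ is infinitesimally rigid.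
   Context: $\mathbb{E}^d=\{x\in\mathbb{R}^{d+1}\mid x_0=1\}$ is Euclidean $d$-space, embedded in $\mathbb{RP}^d$ as an affine chart; projective transformations of $\mathbb{RP}^d$ are induced by linear isomorphisms of $\mathbb{R}^{d+1}$. Tangent vectors to $\mathbb{E}^d$ are identified with $\mathbb{R}^d$. $\Gamma$ is a finite simple graph with vertex set $\Gamma_0$ and edge set $\Gamma_1$. A framework $(\Gamma,p)$ in $\mathbb{E}^d$ is $\Gamma$ with a map $p\colon\Gamma_0\to\mathbb{E}^d$ such that $p_i\ne p_j$ for every $ij\in\Gamma_1$. Kinematics: a vector field $q\colon\Gamma_0\to\mathbb{R}^d$ on $(\Gamma,p)$ is an infinitesimal isometric deformation if for some (equivalently, every) smooth family $(\Gamma,p(t))$ with $p(0)=p$, $\dot p_i(0)=q_i$, one has $\frac{d}{dt}|_{t=0}\operatorname{dist}(p_i(t),p_j(t))=0$ for all $ij\in\Gamma_1$; it is trivial if $q_i=K(p_i)$ for all $i$ for some Killing field $K$ of $\mathbb{E}^d$. $V(\Gamma,p)$ and $V_0(\Gamma,p)$ are the spaces of all, respectively trivial, infinitesimal isometric deformations; $\dim V/V_0$ is the number of kinematic degrees of freedom; the framework is infinitesimally rigid if it is $0$. Statics: a force is a pair $(p,f)$, $p\in\mathbb{E}^d$, $f\in\mathbb{R}^d$; systems of forces are finite formal sums of forces up to the equivalence generated by $(p,0)\sim0$, $\lambda_1(p,f_1)+\lambda_2(p,f_2)\sim(p,\lambda_1f_1+\lambda_2f_2)$, $(p,f)\sim(p+\lambda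 f,f)$. A load $f\colon\Gamma_0\to\mathbb{R}^d$ is an equilibrium load if $\sum_i(p_i,f_i)\sim0$; it is resolvable if there are numbers $w_{ij}=w_{ji}$, $ij\in\Gamma_1$, with $f_i=\sum_{j:\,ij\in\Gamma_1}w_{ij}(p_j-p_i)$ for all $i$. $F(\Gamma,p)\supset F_0(\Gamma,p)$ are the spaces of equilibrium and resolvable loads; $\dim F/F_0$ is the number of static degrees of freedom. *)

theory Defs
  imports "HOL-Analysis.Analysis" "HOL-Analysis.Finite_Function_Topology"
begin

section \<open>Dimension of a quotient space\<close>

text \<open>
  \<open>B\<close> is a system of representatives of a (finite) basis of the quotient \<open>U / W\<close>:
  modulo \<open>W\<close>, every element of \<open>U\<close> is a unique linear combination of elements of \<open>B\<close>.
  The coefficients are normalised to vanish outside \<open>B\<close>.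
\<close>

definition quotient_basis :: "'a::real_vector set \<Rightarrow> 'a set \<Rightarrow> 'a set \<Rightarrow> bool" where
  "quotient_basis U W B \<longleftrightarrow> finite B \<and> B \<subseteq> U \<and>
     (\<forall>u\<in>U. \<exists>!c. (\<forall>b. b \<notin> B \<longrightarrow> c b = 0) \<and> u - (\<Sum>b\<in>B. c b *\<^sub>R b) \<in> W)"

definition quotient_dim :: "'a::real_vector set \<Rightarrow> 'a set \<Rightarrow> nat" where
  "quotient_dim U W = (THE n. \<exists>B. quotient_basis U W B \<and> card B = n)"

lemma quotient_basis_card:
  fixes U W B :: "'a::real_vector set"
  assumes U: "subspace U" and W: "subspace W" "W \<subseteq> U"
    and S: "finite S" "U \<subseteq> span S" and B: "quotient_basis U W B"
  shows "dim U = card B + dim W"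
proof -
  obtain A where A: "A \<subseteq> W" "independent A" "W \<subseteq> span A" "card A = dim W"
    by (rule basis_exists)
  have finA: "finite A"
    using independent_span_bound[OF S(1) A(2)] A(1) W(2) S(2) by blast
  have finB: "finite B" and BU: "B \<subseteq> U"
    and ex: "\<And>u. u \<in> U \<Longrightarrow> \<exists>!c. (\<forall>b. b \<notin> B \<longrightarrow> c b = 0) \<and> u - (\<Sum>b\<in>B. c b *\<^sub>R b) \<in> W"
    using B[unfolded quotient_basis_def] by simp_all
  have zero: "c b = 0" if "(\<Sum>b\<in>B. c b *\<^sub>R b) \<in> W" "b \<in> B" for c b
  proof -
    let ?c = "\<lambda>b. if b \<in> B then c b else 0"
    have "(\<Sum>b\<in>B. ?c b *\<^sub>R b) = (\<Sum>b\<in>B. c b *\<^sub>R b)" by (rule sum.cong) auto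
    hence 1: "(\<forall>b. b \<notin> B \<longrightarrow> ?c b = 0) \<and> 0 - (\<Sum>b\<in>B. ?c b *\<^sub>R b) \<in> W"
      using that(1) W(1) by (simp add: subspace_neg)
    have 2: "(\<forall>b. b \<notin> B \<longrightarrow> (\<lambda>_. 0) b = 0) \<and> 0 - (\<Sum>b\<in>B. (\<lambda>_. 0::real) b *\<^sub>R b) \<in> W"
      using W(1) by (simp add: subspace_0)
    obtain c0 where c0: "\<forall>d. (\<forall>b. b \<notin> B \<longrightarrow> d b = 0) \<and> 0 - (\<Sum>b\<in>B. d b *\<^sub>R b) \<in> W \<longrightarrow> d = c0"
      using ex[OF subspace_0[OF U]] by (rule ex1E)
    have "?c = (\<lambda>_. 0)"
      using mp[OF spec[OF c0] 1] mp[OF spec[OF c0] 2] by (rule trans[OF _ sym])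
    from fun_cong[OF this, of b] that(2) show ?thesis by simp
  qed
  have disj: "B \<inter> A = {}"
  proof (rule ccontr)
    assume "B \<inter> A \<noteq> {}"
    then obtain b where b: "b \<in> B" "b \<in> A" by blast
    have "(\<Sum>x\<in>B. (if x = b then 1 else 0) *\<^sub>R x) = (\<Sum>x\<in>B. if x = b then x else 0)"
      by (rule sum.cong) auto
    hence "(\<Sum>x\<in>B. (if x = b then 1 else 0) *\<^sub>R x) = b" using b(1) finB by simp
    with zero[of "\<lambda>x. if x = b then 1 else 0" b] b A(1) show False by auto
  qed
  have sub: "A \<union> B \<subseteq> U" using A(1) W(2) BU by blast
  have "U \<subseteq> span (A \<union> B)"
  proof
    fix u assume "u \<in> U"
    from ex[OF this] obtain c where "u - (\<Sum>b\<in>B. c b *\<^sub>R b) \<in> W" by (elim ex1E conjE)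
    hence "u - (\<Sum>b\<in>B. c b *\<^sub>R b) \<in> span (A \<union> B)"
      using A(3) span_mono[of A "A \<union> B"] by blast
    moreover have "(\<Sum>b\<in>B. c b *\<^sub>R b) \<in> span (A \<union> B)"
      by (intro span_sum span_scale span_base) auto
    ultimately have "(u - (\<Sum>b\<in>B. c b *\<^sub>R b)) + (\<Sum>b\<in>B. c b *\<^sub>R b) \<in> span (A \<union> B)"
      by (rule span_add)
    thus "u \<in> span (A \<union> B)" by simp
  qed
  moreover have "independent (A \<union> B)"
  proof (rule independent_if_scalars_zero)
    show "finite (A \<union> B)" using finA finB by simp
    fix r x assume sum0: "(\<Sum>x\<in>A \<union> B. r x *\<^sub>R x) = 0" and x: "x \<in> A \<union> B"
    have split: "(\<Sum>x\<in>A. r x *\<^sub>R x) + (\<Sum>x\<in>B. r x *\<^sub>R x) = 0"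
      using sum0 finA finB disj by (subst (asm) sum.union_disjoint) auto
    have "(\<Sum>x\<in>A. r x *\<^sub>R x) \<in> W"
      using A(1) W(1) by (intro subspace_sum subspace_scale) auto
    hence "- (\<Sum>x\<in>A. r x *\<^sub>R x) \<in> W" by (rule subspace_neg[OF W(1)])
    also have "- (\<Sum>x\<in>A. r x *\<^sub>R x) = (\<Sum>x\<in>B. r x *\<^sub>R x)"
      using split by (simp add: neg_eq_iff_add_eq_0)
    finally have "(\<Sum>x\<in>B. r x *\<^sub>R x) \<in> W" .
    hence rB: "r b = 0" if "b \<in> B" for b using that by (rule zero)
    hence "(\<Sum>x\<in>A. r x *\<^sub>R x) = 0" using split by simp
    hence "r a = 0" if "a \<in> A" for a
      using that by (rule independentD[OF A(2) finA order_refl])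
    thus "r x = 0" using rB x by blast
  qed
  ultimately have "dim U = card (A \<union> B)"
    using sub by (intro dim_unique) auto
  thus ?thesis using card_Un_disjoint[OF finA finB] disj A(4) by (simp add: Int_commute)
qed

lemma quotient_basis_exists:
  fixes U W :: "'a::real_vector set"
  assumes U: "subspace U" and W: "subspace W" "W \<subseteq> U" and S: "finite S" "U \<subseteq> span S"
  shows "\<exists>B. quotient_basis U W B"
proof -
  obtain A where A: "A \<subseteq> W" "independent A" "W \<subseteq> span A"
    using basis_exists[of W] by metis
  have "A \<subseteq> U" using A(1) W(2) by blast
  then obtain C where C: "A \<subseteq> C" "C \<subseteq> U" "independent C" "U \<subseteq> span C"
    by (rule maximal_independent_subset_extend[OF _ A(2)])
  have finC: "finite C"
    using independent_span_bound[OF S(1) C(3)] C(2) S(2) by blast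
  have spanA: "span A = W" using A(1,3) W(1) span_minimal by blast
  define B where "B = C - A"
  have fin: "finite A" "finite B" and AB: "C = A \<union> B" "A \<inter> B = {}"
    using finC C(1) finite_subset by (auto simp: B_def)
  have "\<exists>!c. (\<forall>b. b \<notin> B \<longrightarrow> c b = 0) \<and> u - (\<Sum>b\<in>B. c b *\<^sub>R b) \<in> W" if uU: "u \<in> U" for u
  proof (rule ex_ex1I)
    obtain r where "u = (\<Sum>x\<in>C. r x *\<^sub>R x)"
      using subsetD[OF C(4) uU] unfolding span_finite[OF finC] by blast
    hence r: "u = (\<Sum>x\<in>A. r x *\<^sub>R x) + (\<Sum>x\<in>B. r x *\<^sub>R x)"
      using sum.union_disjoint[OF fin AB(2)] AB(1) by simp
    let ?c = "\<lambda>b. if b \<in> B then r b else 0"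
    have "(\<Sum>b\<in>B. ?c b *\<^sub>R b) = (\<Sum>b\<in>B. r b *\<^sub>R b)" by (rule sum.cong) auto
    hence "u - (\<Sum>b\<in>B. ?c b *\<^sub>R b) = (\<Sum>x\<in>A. r x *\<^sub>R x)" using r by simp
    also have "\<dots> \<in> W" using A(1) W(1) by (intro subspace_sum subspace_scale) auto
    finally show "\<exists>c. (\<forall>b. b \<notin> B \<longrightarrow> c b = 0) \<and> u - (\<Sum>b\<in>B. c b *\<^sub>R b) \<in> W"
      by (intro exI[of _ ?c]) simp
  next
    fix c d
    assume c: "(\<forall>b. b \<notin> B \<longrightarrow> c b = 0) \<and> u - (\<Sum>b\<in>B. c b *\<^sub>R b) \<in> W"
      and d: "(\<forall>b. b \<notin> B \<longrightarrow> d b = 0) \<and> u - (\<Sum>b\<in>B. d b *\<^sub>R b) \<in> W"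
    have "(u - (\<Sum>b\<in>B. d b *\<^sub>R b)) - (u - (\<Sum>b\<in>B. c b *\<^sub>R b)) \<in> W"
      using c d W(1) by (blast intro: subspace_diff)
    moreover have "(u - (\<Sum>b\<in>B. d b *\<^sub>R b)) - (u - (\<Sum>b\<in>B. c b *\<^sub>R b))
        = (\<Sum>b\<in>B. (c b - d b) *\<^sub>R b)"
      by (simp add: scaleR_left_diff_distrib sum_subtractf)
    ultimately have "(\<Sum>b\<in>B. (c b - d b) *\<^sub>R b) \<in> span A" using spanA by simp
    then obtain r where r: "(\<Sum>b\<in>B. (c b - d b) *\<^sub>R b) = (\<Sum>x\<in>A. r x *\<^sub>R x)"
      unfolding span_finite[OF fin(1)] by blast
    let ?e = "\<lambda>x. if x \<in> B then c x - d x else - r x"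
    have eA: "(\<Sum>x\<in>A. ?e x *\<^sub>R x) = - (\<Sum>x\<in>A. r x *\<^sub>R x)"
      unfolding sum_negf[symmetric] using AB(2) by (intro sum.cong) auto
    have eB: "(\<Sum>x\<in>B. ?e x *\<^sub>R x) = (\<Sum>b\<in>B. (c b - d b) *\<^sub>R b)"
      by (intro sum.cong) auto
    have "(\<Sum>x\<in>C. ?e x *\<^sub>R x) = 0"
      unfolding AB(1) sum.union_disjoint[OF fin AB(2)] eA eB r by simp
    hence "?e b = 0" if "b \<in> C" for b
      using that by (rule independentD[OF C(3) finC order_refl])
    hence "c b = d b" if "b \<in> B" for b using that AB(1) by fastforce
    thus "c = d" using c d by (intro ext) metis
  qed
  hence "quotient_basis U W B"
    using fin(2) C(2) unfolding quotient_basis_def B_def by blast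
  thus ?thesis ..
qed

lemma quotient_dim_eq:
  fixes U W :: "'a::real_vector set"
  assumes "subspace U" "subspace W" "W \<subseteq> U" "finite S" "U \<subseteq> span S"
  shows "quotient_dim U W = dim U - dim W"
proof -
  have card: "card B = dim U - dim W" if "quotient_basis U W B" for B
    using quotient_basis_card[OF assms that] by simp
  show ?thesis
    unfolding quotient_dim_def
    using quotient_basis_exists[OF assms] card by (intro the_equality) auto
qed


section \<open>Frameworks\<close>

text \<open>
  Euclidean space \<open>E\<^sup>d\<close>, i.e. the hyperplane \<open>{1} \<times> \<real>\<^sup>d\<close> of \<open>\<real> \<times> \<real>\<^sup>d\<close>, is coordinatised
  by \<^typ>\<open>real ^ 'd\<close>.
\<close>

definition simple_graph :: "'v set \<Rightarrow> 'v set set \<Rightarrow> bool" where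
  "simple_graph V E \<longleftrightarrow> finite V \<and> (\<forall>e\<in>E. \<exists>i\<in>V. \<exists>j\<in>V. i \<noteq> j \<and> e = {i, j})"

definition framework :: "'v set \<Rightarrow> 'v set set \<Rightarrow> ('v \<Rightarrow> real ^ 'd) \<Rightarrow> bool" where
  "framework V E p \<longleftrightarrow> simple_graph V E \<and> (\<forall>i j. {i, j} \<in> E \<longrightarrow> p i \<noteq> p j)"

text \<open>
  Vector fields and loads on the finite vertex set \<open>V\<close>, i.e. maps \<open>V \<rightarrow> \<real>\<^sup>d\<close>, are represented
  by their extensions by zero.
\<close>

definition vector_fields :: "'v set \<Rightarrow> ('v \<Rightarrow>\<^sub>0 real ^ 'd) set" where
  "vector_fields V = {q. Poly_Mapping.keys q \<subseteq> V}"


section \<open>Kinematics\<close>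

text \<open>\<open>C\<^sup>\<infinity>\<close> curves on an open set of parameters; \<open>D n\<close> is the \<open>n\<close>-th derivative.\<close>

definition smooth_curve_on :: "real set \<Rightarrow> (real \<Rightarrow> 'a::real_normed_vector) \<Rightarrow> bool" where
  "smooth_curve_on I c \<longleftrightarrow> open I \<and>
     (\<exists>D :: nat \<Rightarrow> real \<Rightarrow> 'a. D 0 = c \<and>
        (\<forall>n. \<forall>t\<in>I. (D n has_vector_derivative D (Suc n) t) (at t)))"

definition isometric_deformations ::
    "'v set \<Rightarrow> 'v set set \<Rightarrow> ('v \<Rightarrow> real ^ 'd) \<Rightarrow> ('v \<Rightarrow>\<^sub>0 real ^ 'd) set" where
  "isometric_deformations V E p = {q \<in> vector_fields V.
     \<exists>\<epsilon>>0. \<exists>P :: real \<Rightarrow> 'v \<Rightarrow> real ^ 'd.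
       (\<forall>t\<in>{-\<epsilon><..<\<epsilon>}. framework V E (P t)) \<and>
       (\<forall>i\<in>V. smooth_curve_on {-\<epsilon><..<\<epsilon>} (\<lambda>t. P t i) \<and> P 0 i = p i \<and>
          ((\<lambda>t. P t i) has_vector_derivative Poly_Mapping.lookup q i) (at 0)) \<and>
       (\<forall>i j. {i, j} \<in> E \<longrightarrow>
          ((\<lambda>t. dist (P t i) (P t j)) has_real_derivative 0) (at 0))}"

text \<open>
  Killing's equation in flat space: the derivative of \<open>K\<close> is skew-symmetric everywhere.
  Such a \<open>K\<close> is automatically affine, hence smooth.
\<close>

definition killing_field :: "(real ^ 'd \<Rightarrow> real ^ 'd) \<Rightarrow> bool" where
  "killing_field K \<longleftrightarrow> (\<forall>x. \<exists>D. (K has_derivative D) (at x) \<and>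
     (\<forall>u v. D u \<bullet> v + u \<bullet> D v = 0))"

definition trivial_deformations ::
    "'v set \<Rightarrow> ('v \<Rightarrow> real ^ 'd) \<Rightarrow> ('v \<Rightarrow>\<^sub>0 real ^ 'd) set" where
  "trivial_deformations V p = {q \<in> vector_fields V.
     \<exists>K. killing_field K \<and> (\<forall>i\<in>V. Poly_Mapping.lookup q i = K (p i))}"

definition kinematic_dof :: "'v set \<Rightarrow> 'v set set \<Rightarrow> ('v \<Rightarrow> real ^ 'd) \<Rightarrow> nat" where
  "kinematic_dof V E p = quotient_dim (isometric_deformations V E p) (trivial_deformations V p)"

definition infinitesimally_rigid :: "'v set \<Rightarrow> 'v set set \<Rightarrow> ('v \<Rightarrow> real ^ 'd) \<Rightarrow> bool" where
  "infinitesimally_rigid V E p \<longleftrightarrow> kinematic_dof V E p = 0"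


section \<open>Statics\<close>

text \<open>
  The finite formal sums \<open>\<Sum>\<^sub>k \<lambda>\<^sub>k (p\<^sub>k, f\<^sub>k)\<close> of forces form the free real vector space over all
  pairs (point, vector).  The three relations generate a linear congruence on it.
\<close>

type_synonym 'd force_system = "((real ^ 'd) \<times> (real ^ 'd)) \<Rightarrow>\<^sub>0 real"

definition force :: "real ^ 'd \<Rightarrow> real ^ 'd \<Rightarrow> 'd force_system" where
  "force p f = Poly_Mapping.single (p, f) 1"

inductive force_equiv :: "'d::finite force_system \<Rightarrow> 'd force_system \<Rightarrow> bool"
    (infix "\<approx>\<^sub>F" 50) where
  zero_force: "force p 0 \<approx>\<^sub>F 0"
| combine: "a *\<^sub>R force p f + b *\<^sub>R force p g \<approx>\<^sub>F force p (a *\<^sub>R f + b *\<^sub>R g)"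
| slide: "force p f \<approx>\<^sub>F force (p + a *\<^sub>R f) f"
| refl: "x \<approx>\<^sub>F x"
| sym: "x \<approx>\<^sub>F y \<Longrightarrow> y \<approx>\<^sub>F x"
| trans: "x \<approx>\<^sub>F y \<Longrightarrow> y \<approx>\<^sub>F z \<Longrightarrow> x \<approx>\<^sub>F z"
| add: "x \<approx>\<^sub>F y \<Longrightarrow> x + z \<approx>\<^sub>F y + z"
| scale: "x \<approx>\<^sub>F y \<Longrightarrow> a *\<^sub>R x \<approx>\<^sub>F a *\<^sub>R y"

definition equilibrium_loads :: "'v set \<Rightarrow> ('v \<Rightarrow> real ^ 'd) \<Rightarrow> ('v \<Rightarrow>\<^sub>0 real ^ 'd) set" where
  "equilibrium_loads V p =
     {f \<in> vector_fields V. (\<Sum>i\<in>V. force (p i) (Poly_Mapping.lookup f i)) \<approx>\<^sub>F 0}"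

definition resolvable_loads ::
    "'v set \<Rightarrow> 'v set set \<Rightarrow> ('v \<Rightarrow> real ^ 'd) \<Rightarrow> ('v \<Rightarrow>\<^sub>0 real ^ 'd) set" where
  "resolvable_loads V E p = {f \<in> vector_fields V.
     \<exists>w :: 'v \<Rightarrow> 'v \<Rightarrow> real. (\<forall>i j. {i, j} \<in> E \<longrightarrow> w i j = w j i) \<and>
       (\<forall>i\<in>V. Poly_Mapping.lookup f i = (\<Sum>j | {i, j} \<in> E. w i j *\<^sub>R (p j - p i)))}"

definition static_dof :: "'v set \<Rightarrow> 'v set set \<Rightarrow> ('v \<Rightarrow> real ^ 'd) \<Rightarrow> nat" where
  "static_dof V E p = quotient_dim (equilibrium_loads V p) (resolvable_loads V E p)"


section \<open>Projective transformations\<close>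

definition projective_space :: "(real \<times> (real ^ 'd)) set set" where
  "projective_space = {L. subspace L \<and> dim L = 1}"

definition affine_chart :: "real ^ 'd \<Rightarrow> (real \<times> (real ^ 'd)) set" where
  "affine_chart x = span {(1, x)}"

definition projective_transformation ::
    "((real \<times> (real ^ 'd)) set \<Rightarrow> (real \<times> (real ^ 'd)) set) \<Rightarrow> bool" where
  "projective_transformation \<Phi> \<longleftrightarrow>
     (\<exists>M. linear M \<and> bij M \<and> (\<forall>L\<in>projective_space. \<Phi> L = M ` L))"

lemma affine_chart_in_projective_space: "affine_chart x \<in> projective_space"
proof -
  have "(1::real, x) \<noteq> 0" by (simp add: zero_prod_def)
  hence "independent {(1::real, x)}" by (simp add: independent_insert)
  hence "dim {(1::real, x)} = 1" by (simp add: dim_eq_card_independent)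
  thus ?thesis unfolding projective_space_def affine_chart_def by (simp add: subspace_span)
qed

lemma inj_affine_chart: "inj affine_chart"
proof (rule injI)
  fix x y :: "real ^ 'd"
  assume eq: "affine_chart x = affine_chart y"
  have "(1, x) \<in> affine_chart x" unfolding affine_chart_def by (rule span_base) simp
  hence "(1, x) \<in> span {(1::real, y)}" unfolding eq by (simp only: affine_chart_def)
  then obtain k where "(1, x) = k *\<^sub>R (1::real, y)" unfolding span_singleton by blast
  thus "x = y" by simp
qed

text \<open>
  \<open>\<Phi> \<circ> p\<close> as a configuration in \<open>E\<^sup>d\<close>; meaningful at those \<open>i\<close> for which the point
  \<open>\<Phi> (p i)\<close> lies in \<open>E\<^sup>d\<close>, i.e. in \<^term>\<open>range affine_chart\<close>.
\<close>

definition transformed ::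
    "((real \<times> (real ^ 'd)) set \<Rightarrow> (real \<times> (real ^ 'd)) set) \<Rightarrow> ('v \<Rightarrow> real ^ 'd) \<Rightarrow> 'v \<Rightarrow> real ^ 'd" where
  "transformed \<Phi> p = inv affine_chart \<circ> \<Phi> \<circ> affine_chart \<circ> p"

end

theory Submission
  imports Defs
begin

text \<open>
  Embed \<open>E\<^sup>d\<close> as the hyperplane \<open>{1} \<times> \<real>\<^sup>d\<close>. A force \<open>(x, f)\<close> is then the decomposable bivector
  \<open>(1, x) \<and> (0, f)\<close>, and two systems of forces are equivalent if and only if their bivectors have
  the same sum. Bivectors are handled here through the dual objects, the alternating forms \<open>B\<close> on
  \<open>\<real> \<times> \<real>\<^sup>d\<close>: a load is an equilibrium load if and only if \<open>\<Sum>\<^sub>i B (1, p\<^sub>i) (0, f\<^sub>i) = 0\<close> for all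
  \<open>B\<close> (\<open>equilibrium_loads_iff\<close>). The same forms are the Killing fields: \<open>K\<close> is a Killing field if
  and only if \<open>K x \<bullet> f = B (1, x) (0, f)\<close> for some \<open>B\<close> (\<open>trivial_deformations_iff\<close>). So both
  \<open>F\<close> and \<open>V\<^sub>0\<close> are described by linear algebra in \<open>\<real> \<times> \<real>\<^sup>d\<close>, on which projective
  transformations act linearly.

  Let the linear isomorphism \<open>M\<close> induce the transformation, so that \<open>M (1, p\<^sub>i) = a\<^sub>i (1, y\<^sub>i)\<close> with
  \<open>a\<^sub>i \<noteq> 0\<close>. The bivector \<open>(1, p\<^sub>i) \<and> (0, f)\<close> is sent to \<open>a\<^sub>i (1, y\<^sub>i) \<and> M (0, f)\<close>, and
  subtracting from \<open>M (0, f)\<close> its component along \<open>(1, y\<^sub>i)\<close> turns this into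
  \<open>(1, y\<^sub>i) \<and> (0, S\<^sub>i f)\<close> for a linear automorphism \<open>S\<^sub>i\<close> of \<open>\<real>\<^sup>d\<close>, called \<open>force_map\<close> below.
  Applying \<open>S\<^sub>i\<close> at each vertex preserves equilibrium
  because alternating forms pull back along \<open>M\<close>, and it preserves resolvability because
  \<open>S\<^sub>i (p\<^sub>j - p\<^sub>i) = a\<^sub>i a\<^sub>j (y\<^sub>j - y\<^sub>i)\<close>: the stress \<open>w\<^sub>i\<^sub>j\<close> is replaced by the again symmetric
  stress \<open>a\<^sub>i a\<^sub>j w\<^sub>i\<^sub>j\<close>. Velocities pair with forces, so they are transported by the transposed
  inverse of \<open>S\<^sub>i\<close>, which makes \<open>V\<close> and \<open>V\<^sub>0\<close> correspond for the same two reasons.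
  The inverse of \<open>M\<close> gives the inverse maps, hence isomorphisms of the quotients.
\<close>

section \<open>Quotient dimensions under linear isomorphisms\<close>

lemma ex1_iff_of_inverse_maps:
  assumes "\<And>x. P x \<Longrightarrow> Q (f x)" "\<And>y. Q y \<Longrightarrow> P (g y)"
    and "\<And>x. g (f x) = x" "\<And>y. Q y \<Longrightarrow> f (g y) = y"
  shows "(\<exists>!y. Q y) \<longleftrightarrow> (\<exists>!x. P x)"
  using assms by metis

lemma quotient_basis_linear_image_iff:
  assumes T: "linear T" "inj T" and B: "B \<subseteq> U"
  shows "quotient_basis (T ` U) (T ` W) (T ` B) \<longleftrightarrow> quotient_basis U W B"
proof -
  have injB: "inj_on T B" using T(2) inj_on_subset by blast
  have fin: "finite (T ` B) \<longleftrightarrow> finite B" using injB by (rule finite_image_iff)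
  have sum_eq: "T u - (\<Sum>b\<in>T ` B. c b *\<^sub>R b) = T (u - (\<Sum>b\<in>B. c (T b) *\<^sub>R b))" for u c
    by (simp add: sum.reindex[OF injB] linear_diff[OF T(1)] linear_sum[OF T(1)]
        linear_scale[OF T(1)])
  let ?P = "\<lambda>u c. (\<forall>b. b \<notin> B \<longrightarrow> c b = 0) \<and> u - (\<Sum>b\<in>B. c b *\<^sub>R b) \<in> W"
  let ?Q = "\<lambda>u c. (\<forall>b. b \<notin> T ` B \<longrightarrow> c b = 0) \<and> T u - (\<Sum>b\<in>T ` B. c b *\<^sub>R b) \<in> T ` W"
  have mem: "T x \<in> T ` W \<longleftrightarrow> x \<in> W" for x using T(2) by (rule inj_image_mem_iff)
  \<comment> \<open>Coefficient functions on the two sides correspond, extended by zero off the range of \<open>T\<close>.\<close>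
  let ?g = "\<lambda>c b. if b \<in> range T then c (inv T b) else (0::real)"
  have inv: "inv T (T x) = x" for x using T(2) by simp
  have PQ: "?Q u (?g c)" if "?P u c" for u c
  proof
    show "\<forall>b. b \<notin> T ` B \<longrightarrow> ?g c b = 0" using that inv by auto
    show "T u - (\<Sum>b\<in>T ` B. ?g c b *\<^sub>R b) \<in> T ` W"
      unfolding sum_eq mem using that by (simp add: inv)
  qed
  have QP: "?P u (c \<circ> T)" if "?Q u c" for u c
    using that inj_image_mem_iff[OF T(2)] unfolding sum_eq mem by auto
  have ext_left: "?g (c \<circ> T) = c" if "?Q u c" for u c
    using that by (auto simp: fun_eq_iff inv)
  have ext_right: "?g c \<circ> T = c" for c by (auto simp: fun_eq_iff inv)
  have ex1: "(\<exists>!c. ?Q u c) \<longleftrightarrow> (\<exists>!c. ?P u c)" for u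
  proof (rule ex1_iff_of_inverse_maps[where f = ?g and g = "\<lambda>c. c \<circ> T"])
    show "?P u c \<Longrightarrow> ?Q u (?g c)" for c by (rule PQ)
    show "?Q u c \<Longrightarrow> ?P u (c \<circ> T)" for c by (rule QP)
    show "?g c \<circ> T = c" for c by (rule ext_right)
    show "?Q u c \<Longrightarrow> ?g (c \<circ> T) = c" for c by (rule ext_left)
  qed
  have sub: "T ` B \<subseteq> T ` U" using B by (rule image_mono)
  show ?thesis
    unfolding quotient_basis_def fin ball_simps(9) ex1 using B sub by blast
qed

lemma quotient_dim_linear_image:
  assumes T: "linear T" "inj T"
  shows "quotient_dim (T ` U) (T ` W) = quotient_dim U W"
proof -
  have "(\<exists>B. quotient_basis (T ` U) (T ` W) B \<and> card B = n)
      \<longleftrightarrow> (\<exists>B. quotient_basis U W B \<and> card B = n)" for n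
  proof safe
    fix C assume C: "quotient_basis (T ` U) (T ` W) C"
    then obtain B where B: "B \<subseteq> U" "C = T ` B"
      unfolding quotient_basis_def by (auto simp: subset_image_iff)
    thus "\<exists>B. quotient_basis U W B \<and> card B = card C"
      using C quotient_basis_linear_image_iff[OF T B(1)] card_image inj_on_subset[OF T(2)]
      by (metis subset_UNIV)
  next
    fix B assume B: "quotient_basis U W B"
    hence "B \<subseteq> U" unfolding quotient_basis_def by blast
    thus "\<exists>C. quotient_basis (T ` U) (T ` W) C \<and> card C = card B"
      using B quotient_basis_linear_image_iff[OF T] card_image inj_on_subset[OF T(2)]
      by (metis subset_UNIV)
  qed
  thus ?thesis unfolding quotient_dim_def by simp
qed

lemma quotient_dim_eq_inverse_maps:
  assumes "linear T" and ST: "\<And>x. S (T x) = x" and TS: "\<And>y. T (S y) = y"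
    and "T ` U \<subseteq> U'" "S ` U' \<subseteq> U" "T ` W \<subseteq> W'" "S ` W' \<subseteq> W"
  shows "quotient_dim U W = quotient_dim U' W'"
proof -
  have image: "T ` A = A'" if "T ` A \<subseteq> A'" "S ` A' \<subseteq> A" for A A'
  proof (rule equalityI[OF that(1) subsetI])
    fix y assume "y \<in> A'"
    hence "S y \<in> A" using that(2) by blast
    hence "T (S y) \<in> T ` A" by (rule imageI)
    thus "y \<in> T ` A" by (simp only: TS)
  qed
  have "T ` U = U'" "T ` W = W'" using image[OF assms(4,5)] image[OF assms(6,7)] .
  moreover have "inj T" using ST by (rule inj_on_inverseI)
  ultimately show ?thesis using quotient_dim_linear_image[OF assms(1)] by metis
qed


section \<open>Finitely supported functions\<close>

lemma lookup_scaleR: "Poly_Mapping.lookup (c *\<^sub>R x) k = c *\<^sub>R Poly_Mapping.lookup x k"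
proof -
  have "{k. c *\<^sub>R Poly_Mapping.lookup x k \<noteq> 0} \<subseteq> Poly_Mapping.keys x"
    by (auto simp: in_keys_iff)
  hence "finite {k. c *\<^sub>R Poly_Mapping.lookup x k \<noteq> 0}"
    by (rule finite_subset) simp
  thus ?thesis by (simp add: scaleR_poly_mapping_def)
qed

lemma linear_extension_of_singles:
  fixes g :: "'a \<Rightarrow> real"
  shows "\<exists>\<phi> :: ('a \<Rightarrow>\<^sub>0 real) \<Rightarrow> real. linear \<phi> \<and> (\<forall>k. \<phi> (Poly_Mapping.single k 1) = g k)"
proof -
  define \<phi> where "\<phi> x = (\<Sum>k\<in>Poly_Mapping.keys x. Poly_Mapping.lookup x k * g k)"
    for x :: "'a \<Rightarrow>\<^sub>0 real"
  have \<phi>: "\<phi> x = (\<Sum>k\<in>A. Poly_Mapping.lookup x k * g k)"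
    if "finite A" "Poly_Mapping.keys x \<subseteq> A" for x A
    unfolding \<phi>_def using that by (intro sum.mono_neutral_left) (auto simp: in_keys_iff)
  have "\<phi> (x + y) = \<phi> x + \<phi> y" for x y
  proof -
    let ?A = "Poly_Mapping.keys x \<union> Poly_Mapping.keys y \<union> Poly_Mapping.keys (x + y)"
    have "\<phi> z = (\<Sum>k\<in>?A. Poly_Mapping.lookup z k * g k)" if "z \<in> {x, y, x + y}" for z
      using that by (intro \<phi>) auto
    thus ?thesis by (simp add: lookup_add distrib_right sum.distrib)
  qed
  moreover have "\<phi> (c *\<^sub>R x) = c * \<phi> x" for c x
  proof -
    let ?A = "Poly_Mapping.keys x \<union> Poly_Mapping.keys (c *\<^sub>R x)"
    have "\<phi> z = (\<Sum>k\<in>?A. Poly_Mapping.lookup z k * g k)" if "z \<in> {x, c *\<^sub>R x}" for z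
      using that by (intro \<phi>) auto
    thus ?thesis by (simp add: lookup_scaleR sum_distrib_left mult.assoc)
  qed
  ultimately have "linear \<phi>" by (intro linearI) auto
  moreover have "\<phi> (Poly_Mapping.single k 1) = g k" for k
    by (subst \<phi>[of "{k}"]) auto
  ultimately show ?thesis by blast
qed

text \<open>Apply \<open>L i\<close> at each vertex \<open>i\<close> of \<open>V\<close>. Off \<open>V\<close> nothing is changed, so that the map is
  invertible on the whole space as soon as each \<open>L i\<close> is.\<close>

definition vertexwise ::
    "'v set \<Rightarrow> ('v \<Rightarrow> real ^ 'd \<Rightarrow> real ^ 'd) \<Rightarrow> ('v \<Rightarrow>\<^sub>0 real ^ 'd) \<Rightarrow> ('v \<Rightarrow>\<^sub>0 real ^ 'd)" where
  "vertexwise V L = Poly_Mapping.mapp (\<lambda>i. if i \<in> V then L i else id)"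

lemma lookup_vertexwise:
  assumes "\<And>i. i \<in> V \<Longrightarrow> linear (L i)"
  shows "Poly_Mapping.lookup (vertexwise V L q) i
    = (if i \<in> V then L i (Poly_Mapping.lookup q i) else Poly_Mapping.lookup q i)"
  using assms[THEN linear_0]
  by (auto simp: vertexwise_def lookup_mapp when_def in_keys_iff)

lemma vertexwise_in_vector_fields: "q \<in> vector_fields V \<Longrightarrow> vertexwise V L q \<in> vector_fields V"
  unfolding vector_fields_def vertexwise_def mem_Collect_eq
  by (rule order_trans[OF keys_mapp_subset])

lemma linear_vertexwise:
  assumes "\<And>i. i \<in> V \<Longrightarrow> linear (L i)"
  shows "linear (vertexwise V L)"
  by (intro linearI poly_mapping_eqI)
     (auto simp: lookup_vertexwise[OF assms] lookup_add lookup_scaleR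
       linear_add[OF assms] linear_scale[OF assms])

lemma vertexwise_inverse:
  assumes "\<And>i. i \<in> V \<Longrightarrow> linear (L i)" "\<And>i. i \<in> V \<Longrightarrow> linear (L' i)"
    and "\<And>i v. i \<in> V \<Longrightarrow> L' i (L i v) = v"
  shows "vertexwise V L' (vertexwise V L q) = q"
  by (intro poly_mapping_eqI) (simp add: lookup_vertexwise assms)


section \<open>Alternating forms, systems of forces, and Killing fields\<close>

definition alternating_form :: "('a::real_vector \<Rightarrow> 'a \<Rightarrow> real) \<Rightarrow> bool" where
  "alternating_form B \<longleftrightarrow> bilinear B \<and> (\<forall>u. B u u = 0)"

type_synonym 'd form = "real \<times> (real ^ 'd) \<Rightarrow> real \<times> (real ^ 'd) \<Rightarrow> real"

lemma alternating_form_skew: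
  assumes "alternating_form B"
  shows "B u v = - B v u"
proof -
  have B: "bilinear B" "\<And>u. B u u = 0" using assms unfolding alternating_form_def by auto
  have "B (u + v) (u + v) = B u v + B v u"
    by (simp only: bilinear_ladd[OF B(1)] bilinear_radd[OF B(1)]) (simp add: B(2))
  thus ?thesis using B(2)[of "u + v"] by linarith
qed

lemma alternating_form_compose_linear:
  assumes "alternating_form B" "linear N"
  shows "alternating_form (\<lambda>u v. B (N u) (N v))"
proof -
  have b: "bilinear B" "\<And>u. B u u = 0" using assms(1) unfolding alternating_form_def by auto
  show ?thesis
    unfolding alternating_form_def bilinear_def
    by (auto intro!: linearI simp: linear_add[OF assms(2)] linear_scale[OF assms(2)]
        bilinear_ladd[OF b(1)] bilinear_radd[OF b(1)] bilinear_lmul[OF b(1)] bilinear_rmul[OF b(1)]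
        b(2))
qed

text \<open>For the form of a Killing field, \<open>\<gamma>\<close> is its linear part and \<open>\<beta>\<close> its value at the origin;
  for that of a force functional, \<open>\<gamma>\<close> records the moment and \<open>\<beta>\<close> the resultant.\<close>

lemma alternating_form_block:
  fixes \<gamma> :: "'a::real_vector \<Rightarrow> 'a \<Rightarrow> real"
  assumes \<gamma>: "alternating_form \<gamma>" and \<beta>: "linear \<beta>"
  shows "alternating_form (\<lambda>u v. \<gamma> (snd u) (snd v) + fst u * \<beta> (snd v) - fst v * \<beta> (snd u))"
proof -
  have b: "bilinear \<gamma>" "\<And>u. \<gamma> u u = 0" using \<gamma> unfolding alternating_form_def by auto
  show ?thesis
    unfolding alternating_form_def bilinear_def
    by (auto intro!: linearI simp: bilinear_ladd[OF b(1)] bilinear_radd[OF b(1)]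
        bilinear_lmul[OF b(1)] bilinear_rmul[OF b(1)] linear_add[OF \<beta>] linear_scale[OF \<beta>] b(2)
        algebra_simps)
qed

text \<open>Sliding a force along its line changes the point by a multiple of the force, a change that an
  alternating form does not see.\<close>

lemma alternating_form_force_equiv:
  fixes B :: "'d::finite form" and x y :: "'d force_system"
  assumes B: "alternating_form B" and \<phi>: "linear \<phi>"
    and \<phi>B: "\<And>p f. \<phi> (force p f) = B (1, p) (0, f)"
    and xy: "x \<approx>\<^sub>F y"
  shows "\<phi> x = \<phi> y"
proof -
  have bil: "bilinear B" and self: "\<And>u. B u u = 0" using B unfolding alternating_form_def by auto
  show ?thesis
    using xy
  proof induction
    case (zero_force p)
    have "B (1, p) (0, 0) = 0" using bilinear_rzero[OF bil] by (simp only: zero_prod_def[symmetric])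
    thus ?case by (simp add: \<phi>B linear_0[OF \<phi>])
  next
    case (combine a p f b g)
    have "B (1, p) (0, a *\<^sub>R f + b *\<^sub>R g) = B (1, p) (a *\<^sub>R (0, f) + b *\<^sub>R (0, g))" by simp
    also have "\<dots> = a * B (1, p) (0, f) + b * B (1, p) (0, g)"
      by (simp only: bilinear_radd[OF bil] bilinear_rmul[OF bil] real_scaleR_def)
    finally show ?case by (simp add: \<phi>B linear_add[OF \<phi>] linear_scale[OF \<phi>])
  next
    case (slide p f a)
    have "B (1, p + a *\<^sub>R f) (0, f) = B ((1, p) + a *\<^sub>R (0, f)) (0, f)" by simp
    also have "\<dots> = B (1, p) (0, f) + a * B (0, f) (0, f)"
      by (simp only: bilinear_ladd[OF bil] bilinear_lmul[OF bil] real_scaleR_def)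
    finally show ?case by (simp add: \<phi>B self)
  qed (auto simp: linear_add[OF \<phi>] linear_scale[OF \<phi>])
qed

lemma subspace_null_systems: "subspace {x :: 'd::finite force_system. x \<approx>\<^sub>F 0}"
proof (rule subspaceI)
  show "0 \<in> {x :: 'd force_system. x \<approx>\<^sub>F 0}" by (simp add: force_equiv.refl)
next
  fix x y :: "'d force_system"
  assume "x \<in> {x. x \<approx>\<^sub>F 0}" "y \<in> {x. x \<approx>\<^sub>F 0}"
  thus "x + y \<in> {x. x \<approx>\<^sub>F 0}"
    using force_equiv.add[of x 0 y] force_equiv.trans[of "x + y" y 0] by simp
next
  fix x :: "'d force_system" and c :: real
  assume "x \<in> {x. x \<approx>\<^sub>F 0}"
  thus "c *\<^sub>R x \<in> {x. x \<approx>\<^sub>F 0}" using force_equiv.scale[of x 0 c] by simp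
qed

lemma linear_functional_eq_of_force_equiv:
  assumes \<phi>: "linear \<phi>" "\<forall>z. z \<approx>\<^sub>F 0 \<longrightarrow> \<phi> z = (0::real)" and "x \<approx>\<^sub>F y"
  shows "\<phi> x = \<phi> y"
proof -
  have "x - y \<approx>\<^sub>F 0" using force_equiv.add[OF assms(3), of "- y"] by simp
  hence "\<phi> (x - y) = 0" using \<phi>(2) by blast
  thus ?thesis by (simp add: linear_diff[OF \<phi>(1)])
qed

text \<open>
  A linear functional on systems of forces that respects equivalence comes from an alternating form.
  Its bilinear block is its value on the couple of \<open>(x, f)\<close> and \<open>(0, -f)\<close>, which is linear in \<open>f\<close>;
  antisymmetry, which yields linearity in \<open>x\<close>, is the parallelogram rule: sliding \<open>(x, f)\<close> and
  \<open>(f, x)\<close> to the common point \<open>x + f\<close> shows that their sum is equivalent to \<open>(0, x + f)\<close>.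
\<close>

lemma alternating_form_of_functional:
  fixes \<phi> :: "'d::finite force_system \<Rightarrow> real"
  assumes \<phi>: "linear \<phi>" "\<forall>z. z \<approx>\<^sub>F 0 \<longrightarrow> \<phi> z = 0"
  shows "\<exists>B :: 'd form. alternating_form B \<and> (\<forall>x f. \<phi> (force x f) = B (1, x) (0, f))"
proof -
  note eq = linear_functional_eq_of_force_equiv[OF \<phi>]
  define \<beta> where "\<beta> = (\<lambda>f. \<phi> (force 0 f))"
  define \<gamma> where "\<gamma> = (\<lambda>x f. \<phi> (force x f) - \<phi> (force 0 f))"
  have comb: "\<phi> (force x (a *\<^sub>R f + b *\<^sub>R g)) = a * \<phi> (force x f) + b * \<phi> (force x g)" for x f g a b
    using eq[OF force_equiv.combine[of a x f b g]]
    by (simp add: linear_add[OF \<phi>(1)] linear_scale[OF \<phi>(1)])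
  have add: "\<phi> (force x (f + g)) = \<phi> (force x f) + \<phi> (force x g)" for x f g
    using comb[of x 1 f 1 g] by simp
  have scale: "\<phi> (force x (a *\<^sub>R f)) = a * \<phi> (force x f)" for x f a
    using comb[of x a f 0 f] by simp
  have slide: "\<phi> (force (x + a *\<^sub>R f) f) = \<phi> (force x f)" for x f a
    using eq[OF force_equiv.slide[of x f a]] by simp
  have \<beta>: "linear \<beta>" unfolding \<beta>_def by (intro linearI) (auto simp: add scale)
  have \<gamma>r: "\<gamma> x (f + g) = \<gamma> x f + \<gamma> x g" "\<gamma> x (a *\<^sub>R f) = a * \<gamma> x f" for x f g a
    unfolding \<gamma>_def by (simp_all add: add scale algebra_simps)
  have skew: "\<gamma> x f = - \<gamma> f x" for x f
  proof -
    have "\<phi> (force x f) + \<phi> (force f x) = \<phi> (force (x + f) f) + \<phi> (force (x + f) x)"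
      using slide[of x 1 f] slide[of f 1 x] by (simp add: add.commute)
    also have "\<dots> = \<phi> (force (x + f) (x + f))" by (simp add: add)
    also have "\<dots> = \<phi> (force 0 (x + f))" using slide[of 0 1 "x + f"] by simp
    finally show ?thesis by (simp add: \<gamma>_def add)
  qed
  have \<gamma>l: "\<gamma> (f + g) x = \<gamma> f x + \<gamma> g x" "\<gamma> (a *\<^sub>R f) x = a * \<gamma> f x" for x f g a
    using skew[of "f + g" x] skew[of "a *\<^sub>R f" x] skew[of f x] skew[of g x] by (simp_all add: \<gamma>r)
  have "\<gamma> u u = 0" for u using skew[of u u] by simp
  hence \<gamma>: "alternating_form \<gamma>"
    unfolding alternating_form_def bilinear_def by (auto intro!: linearI simp: \<gamma>r \<gamma>l)
  let ?B = "\<lambda>u v. \<gamma> (snd u) (snd v) + fst u * \<beta> (snd v) - fst v * \<beta> (snd u)"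
  have "\<forall>x f. \<phi> (force x f) = ?B (1, x) (0, f)" by (simp add: \<gamma>_def \<beta>_def)
  with alternating_form_block[OF \<gamma> \<beta>] show ?thesis by (intro exI[of _ ?B] conjI)
qed

lemma separating_functional:
  fixes N :: "'a::real_vector set"
  assumes "subspace N" "x \<notin> N"
  shows "\<exists>\<phi>. linear \<phi> \<and> (\<forall>z\<in>N. \<phi> z = 0) \<and> \<phi> x = (1::real)"
proof -
  obtain A where A: "A \<subseteq> N" "independent A" "N \<subseteq> span A" using basis_exists[of N] by metis
  have span: "span A = N" using A(1,3) assms(1) span_minimal by blast
  hence "independent (insert x A)" using A(2) assms(2) by (simp add: independent_insertI)
  from linear_independent_extend[OF this, of "\<lambda>z. if z = x then 1 else (0::real)"]
  obtain \<phi> where \<phi>: "linear \<phi>" "\<And>z. z \<in> insert x A \<Longrightarrow> \<phi> z = (if z = x then 1 else (0::real))"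
    by blast
  have "x \<notin> A" using A(1) assms(2) by blast
  hence zero: "\<phi> z = 0" if "z \<in> A" for z using \<phi>(2)[of z] that by auto
  have "\<phi> z = 0" if "z \<in> N" for z
    using linear_eq_0_on_span[OF \<phi>(1) zero] that span by blast
  moreover have "\<phi> x = 1" using \<phi>(2)[of x] by simp
  ultimately show ?thesis using \<phi>(1) by (intro exI[of _ \<phi>] conjI ballI)
qed

text \<open>
  Equilibrium is tested by alternating forms: a system that is not equivalent to \<open>0\<close> is detected by
  some linear functional respecting equivalence, and such functionals are alternating forms.
\<close>

lemma equilibrium_loads_iff:
  fixes p :: "'v \<Rightarrow> real ^ 'd"
  shows "f \<in> equilibrium_loads V p \<longleftrightarrow> f \<in> vector_fields V \<and>
    (\<forall>B :: 'd form. alternating_form B \<longrightarrow> (\<Sum>i\<in>V. B (1, p i) (0, Poly_Mapping.lookup f i)) = 0)"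
proof -
  let ?s = "\<Sum>i\<in>V. force (p i) (Poly_Mapping.lookup f i)"
  have "?s \<approx>\<^sub>F 0 \<longleftrightarrow>
    (\<forall>B :: 'd form. alternating_form B \<longrightarrow> (\<Sum>i\<in>V. B (1, p i) (0, Poly_Mapping.lookup f i)) = 0)"
  proof (intro iffI allI impI)
    fix B :: "'d form"
    assume s: "?s \<approx>\<^sub>F 0" and B: "alternating_form B"
    obtain \<phi> :: "'d force_system \<Rightarrow> real" where \<phi>: "linear \<phi>"
        "\<And>k. \<phi> (Poly_Mapping.single k 1) = (\<lambda>(x, f). B (1, x) (0, f)) k"
      using linear_extension_of_singles by metis
    have force: "\<phi> (force x g) = B (1, x) (0, g)" for x g by (simp add: force_def \<phi>(2))
    show "(\<Sum>i\<in>V. B (1, p i) (0, Poly_Mapping.lookup f i)) = 0"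
      using alternating_form_force_equiv[OF B \<phi>(1) force s]
      by (simp add: linear_sum[OF \<phi>(1)] force linear_0[OF \<phi>(1)])
  next
    assume all: "\<forall>B :: 'd form. alternating_form B \<longrightarrow> (\<Sum>i\<in>V. B (1, p i) (0, Poly_Mapping.lookup f i)) = 0"
    show "?s \<approx>\<^sub>F 0"
    proof (rule ccontr)
      assume "\<not> ?s \<approx>\<^sub>F 0"
      then obtain \<phi> where \<phi>: "linear \<phi>" "\<forall>z. z \<approx>\<^sub>F 0 \<longrightarrow> \<phi> z = (0::real)" "\<phi> ?s = 1"
        using separating_functional[OF subspace_null_systems, of ?s] by auto
      from alternating_form_of_functional[OF \<phi>(1,2)]
      obtain B :: "'d form" where B: "alternating_form B" "\<And>x f. \<phi> (force x f) = B (1, x) (0, f)"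
        by blast
      have "\<phi> ?s = (\<Sum>i\<in>V. B (1, p i) (0, Poly_Mapping.lookup f i))"
        by (simp add: linear_sum[OF \<phi>(1)] B(2))
      thus False using all B(1) \<phi>(3) by simp
    qed
  qed
  thus ?thesis unfolding equilibrium_loads_def by simp
qed

text \<open>
  Along a line, the component of a Killing field in the direction of the line is constant, because
  its derivative is the diagonal of a skew-symmetric form.
\<close>

lemma killing_field_difference_orthogonal:
  assumes "killing_field K"
  shows "(K x - K y) \<bullet> (x - y) = 0"
proof -
  let ?g = "\<lambda>t. K (y + t *\<^sub>R (x - y)) \<bullet> (x - y)"
  have "(?g has_real_derivative 0) (at t)" for t
  proof -
    obtain D where D: "(K has_derivative D) (at (y + t *\<^sub>R (x - y)))"
        "\<And>u v. D u \<bullet> v + u \<bullet> D v = 0"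
      using assms unfolding killing_field_def by blast
    have "((\<lambda>t. y + t *\<^sub>R (x - y)) has_derivative (\<lambda>h. h *\<^sub>R (x - y))) (at t)"
      by (auto intro!: derivative_eq_intros)
    from has_derivative_compose[OF this D(1)]
    have "(?g has_derivative (\<lambda>h. D (h *\<^sub>R (x - y)) \<bullet> (x - y))) (at t)"
      by (rule has_derivative_inner_left)
    moreover have "D (h *\<^sub>R (x - y)) \<bullet> (x - y) = 0" for h
      using D(2)[of "x - y" "x - y"] linear_scale[OF has_derivative_linear[OF D(1)]]
      by (simp add: inner_commute)
    ultimately show ?thesis by (simp add: has_field_derivative_def lambda_zero)
  qed
  hence "?g 1 = ?g 0" by (intro DERIV_isconst_all) auto
  thus ?thesis by (simp add: inner_diff_left)
qed

lemma killing_field_imp_alternating_form: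
  fixes K :: "real ^ 'd \<Rightarrow> real ^ 'd"
  assumes "killing_field K"
  shows "\<exists>B :: 'd form. alternating_form B \<and> (\<forall>x f. K x \<bullet> f = B (1, x) (0, f))"
proof -
  define A where "A = (\<lambda>x. K x - K 0)"
  have self: "A x \<bullet> x = 0" for x
    using killing_field_difference_orthogonal[OF assms, of x 0] by (simp add: A_def)
  have skew: "A x \<bullet> y = - (x \<bullet> A y)" for x y
  proof -
    have "(A x - A y) \<bullet> (x - y) = 0"
      using killing_field_difference_orthogonal[OF assms, of x y] by (simp add: A_def)
    thus ?thesis using self[of x] self[of y]
      by (simp add: inner_diff_left inner_diff_right inner_commute)
  qed
  \<comment> \<open>Skewness moves \<open>A\<close> to the fixed argument, so linearity in the second argument gives linearity of \<open>A\<close>.\<close>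
  have "bilinear (\<lambda>x f. A x \<bullet> f)"
    unfolding bilinear_def
  proof (intro conjI allI)
    show "linear (\<lambda>f. A x \<bullet> f)" for x by (intro linearI) (simp_all add: inner_add_right)
    show "linear (\<lambda>x. A x \<bullet> f)" for f
      unfolding skew by (intro linearI) (simp_all add: inner_add_left)
  qed
  hence A: "alternating_form (\<lambda>x f. A x \<bullet> f)" using self unfolding alternating_form_def by blast
  have \<beta>: "linear (\<lambda>f. K 0 \<bullet> f)" by (intro linearI) (simp_all add: inner_add_right)
  let ?B = "\<lambda>u v. A (snd u) \<bullet> snd v + fst u * (K 0 \<bullet> snd v) - fst v * (K 0 \<bullet> snd u)"
  have "\<forall>x f. K x \<bullet> f = ?B (1, x) (0, f)" by (simp add: A_def inner_diff_left)
  with alternating_form_block[OF A \<beta>] show ?thesis by (intro exI[of _ ?B] conjI)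
qed

lemma vector_eqI_inner:
  fixes u v :: "'a::real_inner"
  assumes "\<And>f. u \<bullet> f = v \<bullet> f"
  shows "u = v"
  using assms by (intro vector_eq_rdot[THEN iffD1]) blast

lemma alternating_form_imp_killing_field:
  fixes B :: "'d::finite form"
  assumes B: "alternating_form B"
  shows "\<exists>K. killing_field K \<and> (\<forall>x f. K x \<bullet> f = B (1, x) (0, f))"
proof -
  have bil: "bilinear B" using B unfolding alternating_form_def by blast
  \<comment> \<open>The vector representing the linear form \<open>f \<mapsto> B u (0, f)\<close>.\<close>
  define R where "R = (\<lambda>u. \<Sum>b\<in>Basis. B u (0, b) *\<^sub>R (b :: real ^ 'd))"
  have R: "R u \<bullet> f = B u (0, f)" for u f
  proof -
    have lin: "linear (\<lambda>f. B u (0, f))"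
    proof (rule linearI)
      show "B u (0, f + g) = B u (0, f) + B u (0, g)" for f g
        by (simp flip: bilinear_radd[OF bil])
      show "B u (0, c *\<^sub>R f) = c *\<^sub>R B u (0, f)" for c f
        using bilinear_rmul[OF bil, of u c "(0, f)"] by simp
    qed
    have "B u (0, f) = B u (0, \<Sum>b\<in>Basis. (f \<bullet> b) *\<^sub>R b)" by (simp add: euclidean_representation)
    also have "\<dots> = (\<Sum>b\<in>Basis. (f \<bullet> b) * B u (0, b))"
      by (simp add: linear_sum[OF lin] linear_scale[OF lin])
    finally show ?thesis
      unfolding R_def inner_sum_left by (simp add: inner_commute[of f] mult.commute)
  qed
  let ?D = "\<lambda>h. R (0, h)"
  have linD: "linear ?D"
  proof (rule linearI; rule vector_eqI_inner)
    show "?D (x + y) \<bullet> f = (?D x + ?D y) \<bullet> f" for x y f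
      by (simp add: inner_add_left R flip: bilinear_ladd[OF bil])
    show "?D (c *\<^sub>R x) \<bullet> f = (c *\<^sub>R ?D x) \<bullet> f" for c x f
      using bilinear_lmul[OF bil, of c "(0, x)" "(0, f)"] by (simp add: R)
  qed
  have "R (1, x) = R (1, 0) + ?D x" for x
    by (rule vector_eqI_inner) (simp add: inner_add_left R flip: bilinear_ladd[OF bil])
  hence K: "(\<lambda>x. R (1, x)) = (\<lambda>x. R (1, 0) + ?D x)" by (rule ext)
  have "((\<lambda>x. R (1, 0) + ?D x) has_derivative ?D) (at x)" for x
    using linear_imp_has_derivative[OF linD] by (auto intro!: derivative_eq_intros)
  hence "((\<lambda>x. R (1, x)) has_derivative ?D) (at x)" for x unfolding K .
  moreover have "?D u \<bullet> v + u \<bullet> ?D v = 0" for u v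
    using alternating_form_skew[OF B, of "(0, u)" "(0, v)"] by (simp add: R inner_commute[of u])
  ultimately have "killing_field (\<lambda>x. R (1, x))" unfolding killing_field_def by blast
  thus ?thesis using R by blast
qed

lemma trivial_deformations_iff:
  fixes p :: "'v \<Rightarrow> real ^ 'd"
  shows "q \<in> trivial_deformations V p \<longleftrightarrow> q \<in> vector_fields V \<and>
    (\<exists>B :: 'd form. alternating_form B \<and> (\<forall>i\<in>V. \<forall>f. Poly_Mapping.lookup q i \<bullet> f = B (1, p i) (0, f)))"
proof -
  have "(\<exists>K. killing_field K \<and> (\<forall>i\<in>V. Poly_Mapping.lookup q i = K (p i))) \<longleftrightarrow>
    (\<exists>B :: 'd form. alternating_form B \<and> (\<forall>i\<in>V. \<forall>f. Poly_Mapping.lookup q i \<bullet> f = B (1, p i) (0, f)))"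
  proof
    assume "\<exists>K. killing_field K \<and> (\<forall>i\<in>V. Poly_Mapping.lookup q i = K (p i))"
    then obtain K where K: "killing_field K" "\<And>i. i \<in> V \<Longrightarrow> Poly_Mapping.lookup q i = K (p i)"
      by blast
    obtain B :: "'d form" where B: "alternating_form B" "\<And>x f. K x \<bullet> f = B (1, x) (0, f)"
      using killing_field_imp_alternating_form[OF K(1)] by blast
    show "\<exists>B :: 'd form. alternating_form B \<and>
        (\<forall>i\<in>V. \<forall>f. Poly_Mapping.lookup q i \<bullet> f = B (1, p i) (0, f))"
      by (intro exI[of _ B] conjI B(1) ballI allI) (simp only: K(2) B(2))
  next
    assume "\<exists>B :: 'd form. alternating_form B \<and>
        (\<forall>i\<in>V. \<forall>f. Poly_Mapping.lookup q i \<bullet> f = B (1, p i) (0, f))"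
    then obtain B :: "'d form" where B: "alternating_form B"
        "\<And>i f. i \<in> V \<Longrightarrow> Poly_Mapping.lookup q i \<bullet> f = B (1, p i) (0, f)" by blast
    obtain K where K: "killing_field K" "\<And>x f. K x \<bullet> f = B (1, x) (0, f)"
      using alternating_form_imp_killing_field[OF B(1)] by blast
    have "Poly_Mapping.lookup q i = K (p i)" if "i \<in> V" for i
      by (rule vector_eqI_inner) (simp add: B(2)[OF that] K(2))
    thus "\<exists>K. killing_field K \<and> (\<forall>i\<in>V. Poly_Mapping.lookup q i = K (p i))" using K(1) by blast
  qed
  thus ?thesis unfolding trivial_deformations_def by simp
qed


section \<open>Infinitesimal isometric deformations\<close>

lemma simple_graph_edge_vertices:
  "simple_graph V E \<Longrightarrow> {i, j} \<in> E \<Longrightarrow> i \<in> V \<and> j \<in> V"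
  unfolding simple_graph_def by (fastforce simp: doubleton_eq_iff)

lemma framework_edge:
  assumes "framework V E p" "{i, j} \<in> E"
  shows "i \<in> V" "j \<in> V" "p i \<noteq> p j"
  using assms(1) simple_graph_edge_vertices[OF _ assms(2), of V] assms(2)
  by (simp_all add: framework_def)

lemma framework_straight_motion:
  fixes p q :: "'v \<Rightarrow> real ^ 'd"
  assumes fw: "framework V E p"
  shows "\<exists>\<epsilon>>0. \<forall>t\<in>{-\<epsilon><..<\<epsilon>}. framework V E (\<lambda>i. p i + t *\<^sub>R q i)"
proof -
  have sg: "simple_graph V E" and ne: "\<And>i j. {i, j} \<in> E \<Longrightarrow> p i \<noteq> p j"
    using fw unfolding framework_def by auto
  have fin: "finite V" using sg unfolding simple_graph_def by blast
  have "\<forall>\<^sub>F t in nhds 0. {i, j} \<in> E \<longrightarrow> p i + t *\<^sub>R q i \<noteq> p j + t *\<^sub>R q j" for i j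
  proof (cases "{i, j} \<in> E")
    case True
    have "((\<lambda>t::real. (p i + t *\<^sub>R q i) - (p j + t *\<^sub>R q j)) \<longlongrightarrow>
        (p i + 0 *\<^sub>R q i) - (p j + 0 *\<^sub>R q j)) (nhds 0)"
      by (intro tendsto_intros filterlim_ident)
    moreover have "(p i + 0 *\<^sub>R q i) - (p j + 0 *\<^sub>R q j) \<noteq> 0" using ne[OF True] by simp
    ultimately have "\<forall>\<^sub>F t in nhds 0. (p i + t *\<^sub>R q i) - (p j + t *\<^sub>R q j) \<noteq> 0"
      by (rule tendsto_imp_eventually_ne)
    thus ?thesis by eventually_elim auto
  qed simp
  hence "\<forall>\<^sub>F t in nhds 0. \<forall>i\<in>V. \<forall>j\<in>V. {i, j} \<in> E \<longrightarrow> p i + t *\<^sub>R q i \<noteq> p j + t *\<^sub>R q j"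
    using fin by (intro eventually_ball_finite ballI) auto
  then obtain \<epsilon> where \<epsilon>: "\<epsilon> > 0" "\<And>t. dist t 0 < \<epsilon> \<Longrightarrow>
      \<forall>i\<in>V. \<forall>j\<in>V. {i, j} \<in> E \<longrightarrow> p i + t *\<^sub>R q i \<noteq> p j + t *\<^sub>R q j"
    unfolding eventually_nhds_metric by blast
  have "framework V E (\<lambda>i. p i + t *\<^sub>R q i)" if "t \<in> {-\<epsilon><..<\<epsilon>}" for t
  proof -
    have "dist t 0 < \<epsilon>" using that by (auto simp: dist_real_def)
    from \<epsilon>(2)[OF this] show ?thesis
      unfolding framework_def using sg simple_graph_edge_vertices[OF sg] by blast
  qed
  thus ?thesis using \<epsilon>(1) by blast
qed

lemma smooth_straight_line: "open I \<Longrightarrow> smooth_curve_on I (\<lambda>t. x + t *\<^sub>R v)"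
  unfolding smooth_curve_on_def
proof (intro conjI exI[of _ "\<lambda>n t. if n = 0 then x + t *\<^sub>R v else if n = 1 then v else 0"] allI ballI)
  fix n and t :: real
  have "((\<lambda>t. x + t *\<^sub>R v) has_vector_derivative v) (at t)"
    by (auto intro!: derivative_eq_intros)
  thus "((\<lambda>t. if n = 0 then x + t *\<^sub>R v else if n = 1 then v else 0) has_vector_derivative
      (if Suc n = 0 then x + t *\<^sub>R v else if Suc n = 1 then v else 0)) (at t)"
    by (cases "n = 0"; cases "n = 1") simp_all
qed auto

text \<open>
  The first-order condition on the bars is linear in the velocities, and whenever it holds the
  straight motion \<open>t \<mapsto> p\<^sub>i + t q\<^sub>i\<close> is a family of frameworks that realises it. Squared
  lengths replace lengths in the computation, since they are inner products.
\<close>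

lemma isometric_deformations_iff:
  fixes p :: "'v \<Rightarrow> real ^ 'd"
  assumes fw: "framework V E p"
  shows "q \<in> isometric_deformations V E p \<longleftrightarrow> q \<in> vector_fields V \<and>
    (\<forall>i j. {i, j} \<in> E \<longrightarrow>
      (p i - p j) \<bullet> (Poly_Mapping.lookup q i - Poly_Mapping.lookup q j) = 0)"
proof -
  have edge: "i \<in> V" "j \<in> V" "p i \<noteq> p j" if "{i, j} \<in> E" for i j
    using framework_edge[OF fw that] by blast+
  let ?q = "Poly_Mapping.lookup q"
  have D: "((\<lambda>t. (dist (P t i) (P t j))\<^sup>2) has_real_derivative
      2 * ((p i - p j) \<bullet> (?q i - ?q j))) (at 0)"
    if P: "\<And>i. i \<in> V \<Longrightarrow> P 0 i = p i \<and> ((\<lambda>t. P t i) has_vector_derivative ?q i) (at 0)"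
      and e: "{i, j} \<in> E" for P i j
  proof -
    have "((\<lambda>t. P t i - P t j) has_vector_derivative (?q i - ?q j)) (at 0)"
      using P edge[OF e] by (intro has_vector_derivative_diff) auto
    hence d: "((\<lambda>t. P t i - P t j) has_derivative (\<lambda>h. h *\<^sub>R (?q i - ?q j))) (at 0)"
      unfolding has_vector_derivative_def .
    have "((\<lambda>t. (P t i - P t j) \<bullet> (P t i - P t j)) has_derivative
        (\<lambda>h. (P 0 i - P 0 j) \<bullet> (h *\<^sub>R (?q i - ?q j)) + (h *\<^sub>R (?q i - ?q j)) \<bullet> (P 0 i - P 0 j)))
        (at 0)"
      by (rule has_derivative_inner[OF d d])
    moreover have "P 0 i = p i" "P 0 j = p j" using P edge[OF e] by auto
    moreover have "(\<lambda>h. (p i - p j) \<bullet> (h *\<^sub>R (?q i - ?q j)) + (h *\<^sub>R (?q i - ?q j)) \<bullet> (p i - p j))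
        = (*) (2 * ((p i - p j) \<bullet> (?q i - ?q j)))"
      by (rule ext) (simp add: inner_commute[of "?q i - ?q j"])
    ultimately show ?thesis
      unfolding has_field_derivative_def dist_norm power2_norm_eq_inner by simp
  qed
  show ?thesis
  proof (intro iffI conjI allI impI)
    assume q: "q \<in> isometric_deformations V E p"
    thus "q \<in> vector_fields V" unfolding isometric_deformations_def by simp
    fix i j assume e: "{i, j} \<in> E"
    from q obtain \<epsilon> and P :: "real \<Rightarrow> 'v \<Rightarrow> real ^ 'd" where
      all: "\<forall>i\<in>V. smooth_curve_on {-\<epsilon><..<\<epsilon>} (\<lambda>t. P t i) \<and> P 0 i = p i \<and>
          ((\<lambda>t. P t i) has_vector_derivative ?q i) (at 0)"
      and dist: "\<forall>i j. {i, j} \<in> E \<longrightarrow>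
          ((\<lambda>t. dist (P t i) (P t j)) has_real_derivative 0) (at 0)"
      unfolding isometric_deformations_def mem_Collect_eq by (elim conjE exE) (rule that)
    have P: "P 0 i = p i \<and> ((\<lambda>t. P t i) has_vector_derivative ?q i) (at 0)" if "i \<in> V" for i
      using all that by simp
    have "((\<lambda>t. dist (P t i) (P t j)) has_real_derivative 0) (at 0)" using dist e by simp
    hence "((\<lambda>t. (dist (P t i) (P t j))\<^sup>2) has_real_derivative 0) (at 0)"
      by (auto intro!: derivative_eq_intros)
    from DERIV_unique[OF D[of P, OF P e] this]
    show "(p i - p j) \<bullet> (?q i - ?q j) = 0" by simp
  next
    assume q: "q \<in> vector_fields V \<and>
      (\<forall>i j. {i, j} \<in> E \<longrightarrow> (p i - p j) \<bullet> (?q i - ?q j) = 0)"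
    define P where "P = (\<lambda>t i. p i + t *\<^sub>R ?q i)"
    have P: "P 0 i = p i \<and> ((\<lambda>t. P t i) has_vector_derivative ?q i) (at 0)" for i
      unfolding P_def by (auto intro!: derivative_eq_intros)
    have dist: "((\<lambda>t. dist (P t i) (P t j)) has_real_derivative 0) (at 0)" if e: "{i, j} \<in> E" for i j
    proof -
      \<comment> \<open>The square root is differentiable because the two end points are distinct.\<close>
      have "((\<lambda>t. (dist (P t i) (P t j))\<^sup>2) has_real_derivative 0) (at 0)"
        using D[of P, OF P e] q e by simp
      moreover have "(dist (P 0 i) (P 0 j))\<^sup>2 > 0" using edge(3)[OF e] P by simp
      ultimately have "((\<lambda>t. sqrt ((dist (P t i) (P t j))\<^sup>2)) has_real_derivative
          inverse (sqrt ((dist (P 0 i) (P 0 j))\<^sup>2)) / 2 * 0) (at 0)"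
        by (intro DERIV_chain2[OF DERIV_real_sqrt])
      thus ?thesis by simp
    qed
    obtain \<epsilon> where \<epsilon>: "\<epsilon> > 0" "\<forall>t\<in>{-\<epsilon><..<\<epsilon>}. framework V E (P t)"
      using framework_straight_motion[OF fw, of ?q] unfolding P_def by blast
    have smooth: "smooth_curve_on {-\<epsilon><..<\<epsilon>} (\<lambda>t. P t i)" for i
      using smooth_straight_line[of "{-\<epsilon><..<\<epsilon>}" "p i" "?q i"] by (simp add: P_def)
    show "q \<in> isometric_deformations V E p"
      unfolding isometric_deformations_def
      by (intro CollectI conjI exI[of _ \<epsilon>] exI[of _ P]) (simp_all add: q \<epsilon> P smooth dist)
  qed
qed


section \<open>Transport of forces and velocities at a single point\<close>

text \<open>
  Here \<open>y\<close> is the image point and \<open>a\<close> the factor in \<open>M (1, x) = a (1, y)\<close>. The bivectors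
  \<open>M (1, x) \<and> M (0, f)\<close> and \<open>(1, y) \<and> (0, force_map M a y f)\<close> coincide.
\<close>

definition force_map ::
    "(real \<times> (real ^ 'd) \<Rightarrow> real \<times> (real ^ 'd)) \<Rightarrow> real \<Rightarrow> real ^ 'd \<Rightarrow> real ^ 'd \<Rightarrow> real ^ 'd" where
  "force_map M a y f = a *\<^sub>R (snd (M (0, f)) - fst (M (0, f)) *\<^sub>R y)"

lemma linear_force_map:
  assumes M: "linear M"
  shows "linear (force_map M a y)"
proof -
  have "M (0, f + g) = M (0, f) + M (0, g)" "M (0, c *\<^sub>R f) = c *\<^sub>R M (0, f)" for f g c
    by (simp_all flip: linear_add[OF M] linear_scale[OF M])
  thus ?thesis by (intro linearI) (simp_all add: force_map_def algebra_simps)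
qed

lemma image_zero_pair_decomp:
  assumes "a \<noteq> 0"
  shows "M (0, f) = fst (M (0, f)) *\<^sub>R (1, y) + inverse a *\<^sub>R (0, force_map M a y f)"
  using assms by (simp add: force_map_def prod_eq_iff)

lemma alternating_form_force_map:
  assumes B: "alternating_form B" and a: "a \<noteq> 0" and xy: "M (1, x) = a *\<^sub>R (1, y)"
  shows "B (1, y) (0, force_map M a y f) = B (M (1, x)) (M (0, f))"
proof -
  have b: "bilinear B" "B (1, y) (1, y) = 0" using B unfolding alternating_form_def by auto
  show ?thesis
    unfolding xy
    by (subst image_zero_pair_decomp[OF a, of M f y])
       (simp only: bilinear_lmul[OF b(1)] bilinear_radd[OF b(1)] bilinear_rmul[OF b(1)] b(2),
        simp add: a)
qed

lemma force_map_inverse: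
  assumes N: "linear N" "\<And>u. N (M u) = u" and a: "a \<noteq> 0" and xy: "M (1, x) = a *\<^sub>R (1, y)"
  shows "force_map N (inverse a) x (force_map M a y f) = f"
proof -
  define c g where "c = fst (M (0, f))" and "g = force_map M a y f"
  have "N (M (1, x)) = a *\<^sub>R N (1, y)" by (simp only: xy linear_scale[OF N(1)])
  hence "(1, x) = a *\<^sub>R N (1, y)" by (simp only: N(2))
  hence N1: "N (1, y) = inverse a *\<^sub>R (1, x)" using a by simp
  have "M (0, f) = c *\<^sub>R (1, y) + inverse a *\<^sub>R (0, g)"
    unfolding c_def g_def by (rule image_zero_pair_decomp[OF a])
  hence "N (M (0, f)) = N (c *\<^sub>R (1, y) + inverse a *\<^sub>R (0, g))" by (rule arg_cong)
  hence eq: "(0, f) = c *\<^sub>R inverse a *\<^sub>R (1, x) + inverse a *\<^sub>R N (0, g)"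
    by (simp only: N(2) N1 linear_add[OF N(1)] linear_scale[OF N(1)])
  have fst: "inverse a * fst (N (0, g)) = - (c * inverse a)"
    using arg_cong[OF eq, of fst] by simp
  have snd: "inverse a *\<^sub>R snd (N (0, g)) = f - (c * inverse a) *\<^sub>R x"
    using arg_cong[OF eq, of snd] by simp
  have "force_map N (inverse a) x g
      = inverse a *\<^sub>R snd (N (0, g)) - (inverse a * fst (N (0, g))) *\<^sub>R x"
    by (simp add: force_map_def scaleR_diff_right)
  also have "\<dots> = f" unfolding fst snd by simp
  finally show ?thesis unfolding g_def .
qed

text \<open>The direction of a bar is sent to the direction of the image bar, and the factor is symmetric
  in the end points.\<close>

lemma force_map_edge:
  assumes M: "linear M" and "M (1, x) = a *\<^sub>R (1, y)" "M (1, x') = a' *\<^sub>R (1, y')"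
  shows "force_map M a y (x' - x) = (a * a') *\<^sub>R (y' - y)"
proof -
  have "M (0, x' - x) = M (1, x') - M (1, x)" by (simp flip: linear_diff[OF M])
  hence "M (0, x' - x) = (a' - a, a' *\<^sub>R y' - a *\<^sub>R y)" by (simp add: assms)
  thus ?thesis by (simp add: force_map_def algebra_simps)
qed


section \<open>Projectively related configurations\<close>

text \<open>
  \<open>y\<close> is the image of \<open>p\<close> under the projective transformation induced by \<open>M\<close>. Carrying the inverse
  \<open>N\<close> along makes the relation symmetric, so that one inclusion between spaces of loads or
  deformations is enough.
\<close>

definition projectively_related ::
    "'v set \<Rightarrow> (real \<times> (real ^ 'd) \<Rightarrow> real \<times> (real ^ 'd)) \<Rightarrow>
     (real \<times> (real ^ 'd) \<Rightarrow> real \<times> (real ^ 'd)) \<Rightarrow>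
     ('v \<Rightarrow> real) \<Rightarrow> ('v \<Rightarrow> real ^ 'd) \<Rightarrow> ('v \<Rightarrow> real ^ 'd) \<Rightarrow> bool" where
  "projectively_related V M N a p y \<longleftrightarrow> linear M \<and> linear N \<and>
     (\<forall>u. N (M u) = u) \<and> (\<forall>u. M (N u) = u) \<and>
     (\<forall>i\<in>V. a i \<noteq> 0 \<and> M (1, p i) = a i *\<^sub>R (1, y i))"

lemma projectively_related_sym:
  assumes "projectively_related V M N a p y"
  shows "projectively_related V N M (\<lambda>i. inverse (a i)) y p"
proof -
  have r: "linear M" "linear N" "\<And>u. N (M u) = u" "\<And>u. M (N u) = u"
    "\<And>i. i \<in> V \<Longrightarrow> a i \<noteq> 0" "\<And>i. i \<in> V \<Longrightarrow> M (1, p i) = a i *\<^sub>R (1, y i)"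
    using assms unfolding projectively_related_def by auto
  have "N (1, y i) = inverse (a i) *\<^sub>R (1, p i)" if "i \<in> V" for i
  proof -
    have "(1, p i) = a i *\<^sub>R N (1, y i)"
      using r(3)[of "(1, p i)"] r(6)[OF that] linear_scale[OF r(2)] by metis
    thus ?thesis using r(5)[OF that] by simp
  qed
  thus ?thesis unfolding projectively_related_def using r by auto
qed

lemma projectively_related_framework:
  assumes r: "projectively_related V M N a p y" and fw: "framework V E p"
  shows "framework V E y"
proof -
  have "y i \<noteq> y j" if e: "{i, j} \<in> E" for i j
  proof
    assume eq: "y i = y j"
    note ij = framework_edge[OF fw e]
    have N: "N (1, y k) = inverse (a k) *\<^sub>R (1, p k)" "a k \<noteq> 0" if "k \<in> V" for k
      using projectively_related_sym[OF r] r that unfolding projectively_related_def by auto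
    have "inverse (a i) *\<^sub>R (1::real, p i) = N (1, y i)" by (rule N(1)[OF ij(1), symmetric])
    also have "\<dots> = inverse (a j) *\<^sub>R (1, p j)" unfolding eq by (rule N(1)[OF ij(2)])
    finally have lines: "inverse (a i) *\<^sub>R (1::real, p i) = inverse (a j) *\<^sub>R (1, p j)" .
    have "inverse (a i) = inverse (a j)" using arg_cong[OF lines, of fst] by simp
    moreover have "inverse (a i) *\<^sub>R p i = inverse (a j) *\<^sub>R p j"
      using arg_cong[OF lines, of snd] by simp
    ultimately have "p i = p j" using N(2)[OF ij(2)] by simp
    thus False using ij(3) by simp
  qed
  thus ?thesis using fw unfolding framework_def by blast
qed

lemma projectively_related_transformed:
  assumes "projective_transformation \<Phi>"
    and chart: "\<forall>i\<in>V. \<Phi> (affine_chart (p i)) \<in> range affine_chart"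
  shows "\<exists>M N a. projectively_related V M N a p (transformed \<Phi> p)"
proof -
  obtain M where M: "linear M" "bij M" "\<And>L. L \<in> projective_space \<Longrightarrow> \<Phi> L = M ` L"
    using assms(1) unfolding projective_transformation_def by blast
  have "\<exists>c. c \<noteq> 0 \<and> M (1, p i) = c *\<^sub>R (1, transformed \<Phi> p i)" if "i \<in> V" for i
  proof -
    have "M ` affine_chart (p i) = affine_chart (transformed \<Phi> p i)"
      using chart that M(3)[OF affine_chart_in_projective_space]
      by (simp add: transformed_def f_inv_into_f)
    moreover have "(1, p i) \<in> affine_chart (p i)"
      unfolding affine_chart_def by (rule span_base) simp
    ultimately have "M (1, p i) \<in> span {(1, transformed \<Phi> p i)}"
      unfolding affine_chart_def by blast
    then obtain c where c: "M (1, p i) = c *\<^sub>R (1, transformed \<Phi> p i)"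
      unfolding span_singleton by blast
    have ne: "M (1, p i) \<noteq> 0"
    proof
      assume "M (1, p i) = 0"
      hence "M (1, p i) = M 0" by (simp add: linear_0[OF M(1)])
      hence "(1::real, p i) = 0" using injD[OF bij_is_inj[OF M(2)]] by blast
      thus False by (simp add: zero_prod_def)
    qed
    have "c \<noteq> 0"
    proof
      assume "c = 0"
      thus False using ne unfolding c by (simp add: zero_prod_def)
    qed
    thus ?thesis using c by blast
  qed
  then obtain a where a: "\<And>i. i \<in> V \<Longrightarrow> a i \<noteq> 0 \<and> M (1, p i) = a i *\<^sub>R (1, transformed \<Phi> p i)"
    by metis
  have inv: "inv M (M u) = u" "M (inv M u) = u" for u
    using M(2) by (simp_all add: bij_is_inj bij_is_surj surj_f_inv_f)
  have "linear (inv M)"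
    by (rule linearI; rule injD[OF bij_is_inj[OF M(2)]])
       (simp_all add: inv linear_add[OF M(1)] linear_scale[OF M(1)])
  hence "projectively_related V M (inv M) a p (transformed \<Phi> p)"
    unfolding projectively_related_def using M(1) inv a by blast
  thus ?thesis by blast
qed


section \<open>Projective invariance of the static degrees of freedom\<close>

definition load_map where
  "load_map V M a y = vertexwise V (\<lambda>i. force_map M (a i) (y i))"

lemma lookup_load_map:
  assumes "linear M" "i \<in> V"
  shows "Poly_Mapping.lookup (load_map V M a y f) i
    = force_map M (a i) (y i) (Poly_Mapping.lookup f i)"
  unfolding load_map_def using assms by (simp add: lookup_vertexwise linear_force_map)

lemma load_map_inverse:
  assumes "projectively_related V M N a p y"
  shows "load_map V N (\<lambda>i. inverse (a i)) p (load_map V M a y f) = f"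
  using assms unfolding load_map_def projectively_related_def
  by (intro vertexwise_inverse linear_force_map force_map_inverse) auto

lemma load_map_equilibrium:
  fixes p y :: "'v \<Rightarrow> real ^ 'd"
  assumes r: "projectively_related V M N a p y" and f: "f \<in> equilibrium_loads V p"
  shows "load_map V M a y f \<in> equilibrium_loads V y"
proof -
  have M: "linear M" using r unfolding projectively_related_def by blast
  have "(\<Sum>i\<in>V. B (1, y i) (0, Poly_Mapping.lookup (load_map V M a y f) i)) = 0"
    if B: "alternating_form B" for B :: "'d form"
  proof -
    have "(\<Sum>i\<in>V. B (1, y i) (0, Poly_Mapping.lookup (load_map V M a y f) i))
        = (\<Sum>i\<in>V. B (M (1, p i)) (M (0, Poly_Mapping.lookup f i)))"
    proof (rule sum.cong[OF HOL.refl])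
      fix i assume i: "i \<in> V"
      hence "a i \<noteq> 0" "M (1, p i) = a i *\<^sub>R (1, y i)"
        using r unfolding projectively_related_def by blast+
      thus "B (1, y i) (0, Poly_Mapping.lookup (load_map V M a y f) i)
          = B (M (1, p i)) (M (0, Poly_Mapping.lookup f i))"
        unfolding lookup_load_map[OF M i] by (rule alternating_form_force_map[OF B])
    qed
    also have "\<dots> = 0"
      using f alternating_form_compose_linear[OF B M] by (auto simp: equilibrium_loads_iff)
    finally show ?thesis .
  qed
  thus ?thesis
    using f by (simp add: equilibrium_loads_iff load_map_def vertexwise_in_vector_fields)
qed

lemma load_map_resolvable:
  assumes r: "projectively_related V M N a p y" and sg: "simple_graph V E"
    and f: "f \<in> resolvable_loads V E p"
  shows "load_map V M a y f \<in> resolvable_loads V E y"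
proof -
  have M: "linear M" "\<And>i. i \<in> V \<Longrightarrow> M (1, p i) = a i *\<^sub>R (1, y i)"
    using r unfolding projectively_related_def by blast+
  obtain w where w: "\<And>i j. {i, j} \<in> E \<Longrightarrow> w i j = w j i"
      "\<And>i. i \<in> V \<Longrightarrow> Poly_Mapping.lookup f i = (\<Sum>j | {i, j} \<in> E. w i j *\<^sub>R (p j - p i))"
    using f unfolding resolvable_loads_def by blast
  let ?w = "\<lambda>i j. a i * a j * w i j"
  have lookup: "Poly_Mapping.lookup (load_map V M a y f) i = (\<Sum>j | {i, j} \<in> E. ?w i j *\<^sub>R (y j - y i))"
    if i: "i \<in> V" for i
  proof -
    note lin = linear_force_map[OF M(1), of "a i" "y i"]
    have "Poly_Mapping.lookup (load_map V M a y f) i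
        = (\<Sum>j | {i, j} \<in> E. w i j *\<^sub>R force_map M (a i) (y i) (p j - p i))"
      by (simp add: lookup_load_map M(1) i w(2) linear_sum[OF lin] linear_scale[OF lin])
    also have "\<dots> = (\<Sum>j | {i, j} \<in> E. ?w i j *\<^sub>R (y j - y i))"
    proof (rule sum.cong[OF HOL.refl])
      fix j assume "j \<in> {j. {i, j} \<in> E}"
      hence "j \<in> V" using simple_graph_edge_vertices[OF sg] by blast
      from force_map_edge[OF M(1) M(2)[OF i] M(2)[OF this]]
      show "w i j *\<^sub>R force_map M (a i) (y i) (p j - p i) = ?w i j *\<^sub>R (y j - y i)"
        by (simp add: mult_ac)
    qed
    finally show ?thesis .
  qed
  have sym: "?w i j = ?w j i" if "{i, j} \<in> E" for i j using w(1)[OF that] by simp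
  have field: "load_map V M a y f \<in> vector_fields V"
    using f by (simp add: resolvable_loads_def load_map_def vertexwise_in_vector_fields)
  show ?thesis
    unfolding resolvable_loads_def
    by (intro CollectI conjI exI[of _ ?w] allI impI ballI field sym lookup)
qed

lemma projectively_related_static_dof:
  assumes r: "projectively_related V M N a p y" and sg: "simple_graph V E"
  shows "static_dof V E p = static_dof V E y"
  unfolding static_dof_def
proof (rule quotient_dim_eq_inverse_maps)
  note r' = projectively_related_sym[OF r]
  let ?T = "load_map V M a y" and ?S = "load_map V N (\<lambda>i. inverse (a i)) p"
  show "linear ?T"
    using r unfolding load_map_def projectively_related_def
    by (intro linear_vertexwise linear_force_map) auto
  show "?S (?T f) = f" for f by (rule load_map_inverse[OF r])
  show "?T (?S f) = f" for f using load_map_inverse[OF r', of f] by simp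
  show "?T ` equilibrium_loads V p \<subseteq> equilibrium_loads V y"
    using load_map_equilibrium[OF r] by blast
  show "?S ` equilibrium_loads V y \<subseteq> equilibrium_loads V p"
    using load_map_equilibrium[OF r'] by blast
  show "?T ` resolvable_loads V E p \<subseteq> resolvable_loads V E y"
    using load_map_resolvable[OF r sg] by blast
  show "?S ` resolvable_loads V E y \<subseteq> resolvable_loads V E p"
    using load_map_resolvable[OF r' sg] by blast
qed


section \<open>Projective invariance of the kinematic degrees of freedom\<close>

text \<open>
  Velocities of \<open>p\<close> are sent to velocities of its image by the adjoint of the map taking forces at
  the image back to forces at \<open>p\<close>; hence \<open>N\<close> stands for the inverse of the linear isomorphism and
  \<open>b\<close> for the inverse factors.
\<close>

definition velocity_map where
  "velocity_map V N b p = vertexwise V (\<lambda>i. adjoint (force_map N (b i) (p i)))"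

lemma inner_lookup_velocity_map:
  assumes "linear N" "i \<in> V"
  shows "Poly_Mapping.lookup (velocity_map V N b p q) i \<bullet> g
    = Poly_Mapping.lookup q i \<bullet> force_map N (b i) (p i) g"
  unfolding velocity_map_def using assms
  by (simp add: lookup_vertexwise linear_force_map adjoint_linear
      adjoint_works[OF linear_force_map] inner_commute)

lemma velocity_map_inverse:
  assumes r: "projectively_related V M N a p y"
  shows "velocity_map V M a y (velocity_map V N (\<lambda>i. inverse (a i)) p q) = q"
  unfolding velocity_map_def
proof (rule vertexwise_inverse)
  have lin: "linear M" "linear N" using r unfolding projectively_related_def by blast+
  note lf = linear_force_map[OF lin(1)] linear_force_map[OF lin(2)]
  fix i assume i: "i \<in> V"
  show "linear (adjoint (force_map N (inverse (a i)) (p i)))"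
    "linear (adjoint (force_map M (a i) (y i)))"
    by (intro adjoint_linear lf)+
  have inv: "force_map N (inverse (a i)) (p i) (force_map M (a i) (y i) f) = f" for f
    using r i unfolding projectively_related_def by (intro force_map_inverse) auto
  fix v
  show "adjoint (force_map M (a i) (y i)) (adjoint (force_map N (inverse (a i)) (p i)) v) = v"
  proof (rule vector_eqI_inner)
    show "adjoint (force_map M (a i) (y i)) (adjoint (force_map N (inverse (a i)) (p i)) v) \<bullet> g
        = v \<bullet> g" for g
      by (simp add: inner_commute[of _ g] adjoint_works[OF lf(1)] adjoint_works[OF lf(2)] inv)
  qed
qed

lemma velocity_map_trivial:
  fixes p y :: "'v \<Rightarrow> real ^ 'd"
  assumes r: "projectively_related V M N a p y" and q: "q \<in> trivial_deformations V p"
  shows "velocity_map V N (\<lambda>i. inverse (a i)) p q \<in> trivial_deformations V y"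
proof -
  note r' = projectively_related_sym[OF r, unfolded projectively_related_def]
  obtain B :: "'d form" where B: "alternating_form B"
      "\<And>i f. i \<in> V \<Longrightarrow> Poly_Mapping.lookup q i \<bullet> f = B (1, p i) (0, f)"
    using q by (auto simp: trivial_deformations_iff)
  have "alternating_form (\<lambda>u v. B (N u) (N v))"
    using r' by (intro alternating_form_compose_linear[OF B(1)]) blast
  moreover have "Poly_Mapping.lookup (velocity_map V N (\<lambda>i. inverse (a i)) p q) i \<bullet> g
      = B (N (1, y i)) (N (0, g))" if "i \<in> V" for i g
  proof -
    have N: "linear N" "inverse (a i) \<noteq> 0" "N (1, y i) = inverse (a i) *\<^sub>R (1, p i)"
      using r' that by blast+
    show ?thesis
      unfolding inner_lookup_velocity_map[OF N(1) that] B(2)[OF that]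
      using N(2,3) by (rule alternating_form_force_map[OF B(1)])
  qed
  moreover have "velocity_map V N (\<lambda>i. inverse (a i)) p q \<in> vector_fields V"
    using q by (simp add: trivial_deformations_def velocity_map_def vertexwise_in_vector_fields)
  ultimately show ?thesis
    unfolding trivial_deformations_iff
    by (intro conjI exI[of _ "\<lambda>u v. B (N u) (N v)"] ballI allI)
qed

lemma velocity_map_isometric:
  assumes r: "projectively_related V M N a p y" and fw: "framework V E p"
    and q: "q \<in> isometric_deformations V E p"
  shows "velocity_map V N (\<lambda>i. inverse (a i)) p q \<in> isometric_deformations V E y"
proof -
  let ?q = "Poly_Mapping.lookup q"
  let ?r = "Poly_Mapping.lookup (velocity_map V N (\<lambda>i. inverse (a i)) p q)"
  let ?b = "\<lambda>i. inverse (a i)"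
  have N: "linear N" "\<And>i. i \<in> V \<Longrightarrow> N (1, y i) = ?b i *\<^sub>R (1, p i)"
    using projectively_related_sym[OF r] unfolding projectively_related_def by blast+
  have "(y i - y j) \<bullet> (?r i - ?r j) = 0" if e: "{i, j} \<in> E" for i j
  proof -
    note ij = framework_edge(1,2)[OF fw e]
    have "?r i \<bullet> (y j - y i) = (?b i * ?b j) * (?q i \<bullet> (p j - p i))"
      by (simp add: inner_lookup_velocity_map[OF N(1) ij(1)]
          force_map_edge[OF N(1) N(2)[OF ij(1)] N(2)[OF ij(2)]])
    moreover have "?r j \<bullet> (y i - y j) = (?b i * ?b j) * (?q j \<bullet> (p i - p j))"
      by (simp add: inner_lookup_velocity_map[OF N(1) ij(2)]
          force_map_edge[OF N(1) N(2)[OF ij(2)] N(2)[OF ij(1)]])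
    ultimately have "(y i - y j) \<bullet> (?r i - ?r j) = (?b i * ?b j) * ((p i - p j) \<bullet> (?q i - ?q j))"
      by (simp add: inner_diff_left inner_diff_right inner_commute algebra_simps)
    thus ?thesis using q e by (simp add: isometric_deformations_iff[OF fw])
  qed
  thus ?thesis
    using q projectively_related_framework[OF r fw]
    by (simp add: isometric_deformations_iff fw velocity_map_def vertexwise_in_vector_fields)
qed

lemma projectively_related_kinematic_dof:
  assumes r: "projectively_related V M N a p y" and fw: "framework V E p"
  shows "kinematic_dof V E p = kinematic_dof V E y"
  unfolding kinematic_dof_def
proof (rule quotient_dim_eq_inverse_maps)
  note r' = projectively_related_sym[OF r]
  note fw' = projectively_related_framework[OF r fw]
  let ?T = "velocity_map V N (\<lambda>i. inverse (a i)) p" and ?S = "velocity_map V M a y"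
  show "linear ?T"
    using r unfolding velocity_map_def projectively_related_def
    by (intro linear_vertexwise adjoint_linear linear_force_map) auto
  show "?S (?T q) = q" for q by (rule velocity_map_inverse[OF r])
  show "?T (?S q) = q" for q using velocity_map_inverse[OF r', of q] by simp
  show "?T ` isometric_deformations V E p \<subseteq> isometric_deformations V E y"
    using velocity_map_isometric[OF r fw] by blast
  show "?S ` isometric_deformations V E y \<subseteq> isometric_deformations V E p"
    using velocity_map_isometric[OF r' fw'] by auto
  show "?T ` trivial_deformations V p \<subseteq> trivial_deformations V y"
    using velocity_map_trivial[OF r] by blast
  show "?S ` trivial_deformations V y \<subseteq> trivial_deformations V p"
    using velocity_map_trivial[OF r'] by auto
qed

theorem theoremB:
  fixes V :: "'v set" and E :: "'v set set" and p :: "'v \<Rightarrow> real ^ 'd"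
    and \<Phi> :: "(real \<times> (real ^ 'd)) set \<Rightarrow> (real \<times> (real ^ 'd)) set"
  assumes "framework V E p"
    and "projective_transformation \<Phi>"
    and "\<forall>i\<in>V. \<Phi> (affine_chart (p i)) \<in> range affine_chart"
  shows "kinematic_dof V E p = kinematic_dof V E (transformed \<Phi> p)
    \<and> static_dof V E p = static_dof V E (transformed \<Phi> p)
    \<and> (infinitesimally_rigid V E p \<longleftrightarrow> infinitesimally_rigid V E (transformed \<Phi> p))"
proof -
  obtain M N a where r: "projectively_related V M N a p (transformed \<Phi> p)"
    using projectively_related_transformed[OF assms(2,3)] by blast
  have "simple_graph V E" using assms(1) unfolding framework_def by blast
  thus ?thesis
    using projectively_related_kinematic_dof[OF r assms(1)] projectively_related_static_dof[OF r]
    by (simp add: infinitesimally_rigid_def)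
qed

end
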